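(* Let $\{X_i\}_{i=1}^{\infty}$ be a convolutionary sequence of $d$-dimensional random vectors on a sublinear expectation space $(\Omega,\mathcal{H},\mathbb{E})$. Then there exist a sublinear expectation space $(\hat{\Omega},\hat{\mathcal{H}},\hat{\mathbb{E}})$ and an independent sequence of $d$-dimensional random vectors $\{\hat{X}_i\}_{i=1}^{\infty}$ on it such that $\hat{X}_i\overset{d}{=}X_i$ for every $i\in\mathbb{N}^{+}$ and $$\mathbb{E}\Big[\varphi\Big(\sum_{i=m+1}^{m+n} X_i\Big)\Big]=\hat{\mathbb{E}}\Big[\varphi\Big(\sum_{i=m+1}^{m+n}\hat{X}_i\Big)\Big]\qquad \text{for all } m\in\mathbb{N},\ n\in\mathbb{N}^{+},\ \varphi\in C_{b,Lip}(\mathbb{R}^d).$$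
   Context: Here $\mathbb{N}=\{0,1,2,\dots\}$ and $\mathbb{N}^+=\{1,2,\dots\}$. Function spaces. $C_{l,Lip}(\mathbb{R}^n)$ is the linear space of functions $\varphi:\mathbb{R}^n\to\mathbb{R}$ for which there are $C>0$ and $m\in\mathbb{N}$ with $|\varphi(x)-\varphi(y)|\le C(1+|x|^m+|y|^m)|x-y|$ for all $x,y\in\mathbb{R}^n$. $C_{b,Lip}(\mathbb{R}^d)$ is the set of bounded Lipschitz continuous functions on $\mathbb{R}^d$. Sublinear expectation space. A triple $(\Omega,\mathcal{H},\mathbb{E})$ where $\mathcal{H}$ is a set of real random variables on $\Omega$ such that $X_1,\dots,X_n\in\mathcal{H}$ implies $\varphi(X_1,\dots,X_n)\in\mathcal{H}$ for every $\varphi\in C_{l,Lip}(\mathbb{R}^n)$, and $\mathbb{E}:\mathcal{H}\to\mathbb{R}$ satisfies, for all $X,Y\in\mathcal{H}$: (1) monotonicity: $X\ge Y$ implies $\mathbb{E}[X]\ge\mathbb{E}[Y]$; (2) $\mathbb{E}[c]=c$ for all $c\in\mathbb{R}$; (3) $\mathbb{E}[X+Y]\le\mathbb{E}[X]+\mathbb{E}[Y]$; (4) $\mathbb{E}[\lambda X]=\lambda\mathbb{E}[X]$ for all $\lambda\ge0$. An $n$-dimensional random vector is $X=(X_1,\dots,X_n)$ with all $X_j\in\mathcal{H}$. Identical distribution. $d$-dimensional random vectors $X_1,X_2$ on sublinear expectation spaces $(\Omega_1,\mathcal{H}_1,\mathbb{E}_1)$, $(\Omega_2,\mathcal{H}_2,\mathbb{E}_2)$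 are identically distributed, $X_1\overset{d}{=}X_2$, if $\mathbb{E}_1[\varphi(X_1)]=\mathbb{E}_2[\varphi(X_2)]$ for every $\varphi\in C_{l,Lip}(\mathbb{R}^d)$. Independence (in the sense of Peng). For random vectors $X$ ($d_1$-dimensional) and $Y$ ($d_2$-dimensional) on $(\Omega,\mathcal{H},\mathbb{E})$, $Y$ is independent from $X$ if $\mathbb{E}[\varphi(X,Y)]=\mathbb{E}\big[\mathbb{E}[\varphi(x,Y)]_{x=X}\big]$ for every $\varphi\in C_{l,Lip}(\mathbb{R}^{d_1+d_2})$. A sequence $\{X_i\}_{i\ge1}$ is independent if $X_{i+1}$ is independent from $(X_1,\dots,X_i)$ for every $i\in\mathbb{N}^+$. Convolution. For $d$-dimensional random vectors $X,Y$ on $(\Omega,\mathcal{H},\mathbb{E})$, "$Y$ and $X$ are of convolution" means $\mathbb{E}[\varphi(X+Y)]=\mathbb{E}\big[\mathbb{E}[\varphi(x+Y)]_{x=X}\big]$ for every $\varphi\in C_{l,Lip}(\mathbb{R}^d)$. A sequence $\{X_i\}_{i\ge1}$ is convolutionary if for all $n\in\mathbb{N}^+$ and $1\le k\le n$, with $S=\sum_{i=k}^{n}X_i$, one has $\mathbb{E}[\varphi(S+X_{n+1})]=\mathbb{E}\big[\mathbb{E}[\varphi(x+X_{n+1})]_{x=S}\big]$ for every $\varphi\in C_{l,Lip}(\mathbb{R}^d)$. *)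

theory Defs
  imports "HOL-Analysis.Analysis"
begin

text \<open>
  A point of \<open>\<real>\<^sup>n\<close> is represented by a function \<open>x :: nat \<Rightarrow> real\<close> of which only the
  coordinates \<open>x 0, \<dots>, x (n - 1)\<close> matter. The dimension has to be a term and not a type,
  because closure of \<open>\<H>\<close> and independence of a sequence quantify over it.
\<close>

definition enorm :: "nat \<Rightarrow> (nat \<Rightarrow> real) \<Rightarrow> real" where
  "enorm n x = L2_set x {..<n}"

definition edist :: "nat \<Rightarrow> (nat \<Rightarrow> real) \<Rightarrow> (nat \<Rightarrow> real) \<Rightarrow> real" where
  "edist n x y = enorm n (\<lambda>j. x j - y j)"

text \<open>
  In both function spaces below, the estimate gives \<open>\<phi> x = \<phi> y\<close> as soon as \<open>x\<close> and \<open>y\<close> agree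
  on the coordinates below \<open>n\<close>, so the members are exactly the functions on \<open>\<real>\<^sup>n\<close> with the
  stated property.
\<close>

definition C_l_Lip :: "nat \<Rightarrow> ((nat \<Rightarrow> real) \<Rightarrow> real) set" where
  "C_l_Lip n = {\<phi>. \<exists>C>0. \<exists>m::nat. \<forall>x y.
     \<bar>\<phi> x - \<phi> y\<bar> \<le> C * (1 + enorm n x ^ m + enorm n y ^ m) * edist n x y}"

definition C_b_Lip :: "nat \<Rightarrow> ((nat \<Rightarrow> real) \<Rightarrow> real) set" where
  "C_b_Lip n = {\<phi>. (\<exists>B. \<forall>x. \<bar>\<phi> x\<bar> \<le> B) \<and> (\<exists>L. \<forall>x y. \<bar>\<phi> x - \<phi> y\<bar> \<le> L * edist n x y)}"

text \<open>
  The sample space is the type \<open>'w\<close>. The functional \<open>E\<close> is only constrained on \<open>H\<close>; its values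
  elsewhere are irrelevant. That constants belong to \<open>H\<close> is implicit in \<open>\<bbbE>[c] = c\<close>.
\<close>

locale sublinear_expectation_space =
  fixes H :: "('w \<Rightarrow> real) set" and E :: "('w \<Rightarrow> real) \<Rightarrow> real"
  assumes closed: "\<And>n X \<phi>. n \<ge> 1 \<Longrightarrow> (\<And>j. j < n \<Longrightarrow> X j \<in> H) \<Longrightarrow> \<phi> \<in> C_l_Lip n
      \<Longrightarrow> (\<lambda>\<omega>. \<phi> (\<lambda>j. X j \<omega>)) \<in> H"
    and mono: "\<And>X Y. X \<in> H \<Longrightarrow> Y \<in> H \<Longrightarrow> (\<And>\<omega>. Y \<omega> \<le> X \<omega>) \<Longrightarrow> E Y \<le> E X"
    and const_mem: "\<And>c. (\<lambda>_. c) \<in> H"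
    and const: "\<And>c. E (\<lambda>_. c) = c"
    and subadd: "\<And>X Y. X \<in> H \<Longrightarrow> Y \<in> H \<Longrightarrow> E (\<lambda>\<omega>. X \<omega> + Y \<omega>) \<le> E X + E Y"
    and pos_homogeneous: "\<And>c X. X \<in> H \<Longrightarrow> 0 \<le> c \<Longrightarrow> E (\<lambda>\<omega>. c * X \<omega>) = c * E X"

definition random_vector :: "('w \<Rightarrow> real) set \<Rightarrow> nat \<Rightarrow> ('w \<Rightarrow> nat \<Rightarrow> real) \<Rightarrow> bool" where
  "random_vector H n X \<longleftrightarrow> (\<forall>j<n. (\<lambda>\<omega>. X \<omega> j) \<in> H)"

definition identically_distributed ::
  "nat \<Rightarrow> (('v \<Rightarrow> real) \<Rightarrow> real) \<Rightarrow> ('v \<Rightarrow> nat \<Rightarrow> real)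
       \<Rightarrow> (('w \<Rightarrow> real) \<Rightarrow> real) \<Rightarrow> ('w \<Rightarrow> nat \<Rightarrow> real) \<Rightarrow> bool" where
  "identically_distributed d E1 X1 E2 X2 \<longleftrightarrow>
     (\<forall>\<phi>\<in>C_l_Lip d. E1 (\<lambda>\<omega>. \<phi> (X1 \<omega>)) = E2 (\<lambda>\<omega>. \<phi> (X2 \<omega>)))"

text \<open>The point \<open>(x, y)\<close> of \<open>\<real>\<^sup>m\<^sup>+\<^sup>n\<close> for \<open>x\<close> in \<open>\<real>\<^sup>m\<close> and \<open>y\<close> in \<open>\<real>\<^sup>n\<close>.\<close>

definition join :: "nat \<Rightarrow> (nat \<Rightarrow> real) \<Rightarrow> (nat \<Rightarrow> real) \<Rightarrow> nat \<Rightarrow> real" where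
  "join m x y = (\<lambda>k. if k < m then x k else y (k - m))"

text \<open>\<open>independent_from E m n X Y\<close>: the \<open>n\<close>-dimensional \<open>Y\<close> is independent from the
  \<open>m\<close>-dimensional \<open>X\<close>. This relation is not symmetric.\<close>

definition independent_from ::
  "(('w \<Rightarrow> real) \<Rightarrow> real) \<Rightarrow> nat \<Rightarrow> nat \<Rightarrow> ('w \<Rightarrow> nat \<Rightarrow> real) \<Rightarrow> ('w \<Rightarrow> nat \<Rightarrow> real) \<Rightarrow> bool" where
  "independent_from E m n X Y \<longleftrightarrow>
     (\<forall>\<phi>\<in>C_l_Lip (m + n).
        E (\<lambda>\<omega>. \<phi> (join m (X \<omega>) (Y \<omega>))) = E (\<lambda>\<omega>. E (\<lambda>\<omega>'. \<phi> (join m (X \<omega>) (Y \<omega>')))))"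

text \<open>
  Sequences of random vectors are indexed from 1; the value at 0 is ignored. The tuple
  \<open>(X\<^sub>1, \<dots>, X\<^sub>i)\<close> of \<open>d\<close>-dimensional vectors is the concatenation of blocks of length \<open>d\<close>,
  i.e. the first \<open>i * d\<close> coordinates of \<open>blocks d X\<close>.
\<close>

definition blocks :: "nat \<Rightarrow> (nat \<Rightarrow> 'w \<Rightarrow> nat \<Rightarrow> real) \<Rightarrow> 'w \<Rightarrow> nat \<Rightarrow> real" where
  "blocks d X \<omega> = (\<lambda>k. X (Suc (k div d)) \<omega> (k mod d))"

definition independent_sequence ::
  "(('w \<Rightarrow> real) \<Rightarrow> real) \<Rightarrow> nat \<Rightarrow> (nat \<Rightarrow> 'w \<Rightarrow> nat \<Rightarrow> real) \<Rightarrow> bool" where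
  "independent_sequence E d X \<longleftrightarrow>
     (\<forall>i\<ge>1. independent_from E (i * d) d (blocks d X) (X (Suc i)))"

text \<open>\<open>of_convolution E d Y X\<close>: \<open>Y\<close> and \<open>X\<close>, in this order, are of convolution.\<close>

definition of_convolution ::
  "(('w \<Rightarrow> real) \<Rightarrow> real) \<Rightarrow> nat \<Rightarrow> ('w \<Rightarrow> nat \<Rightarrow> real) \<Rightarrow> ('w \<Rightarrow> nat \<Rightarrow> real) \<Rightarrow> bool" where
  "of_convolution E d Y X \<longleftrightarrow>
     (\<forall>\<phi>\<in>C_l_Lip d.
        E (\<lambda>\<omega>. \<phi> (\<lambda>j. X \<omega> j + Y \<omega> j)) = E (\<lambda>\<omega>. E (\<lambda>\<omega>'. \<phi> (\<lambda>j. X \<omega> j + Y \<omega>' j))))"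

definition convolutionary_sequence ::
  "(('w \<Rightarrow> real) \<Rightarrow> real) \<Rightarrow> nat \<Rightarrow> (nat \<Rightarrow> 'w \<Rightarrow> nat \<Rightarrow> real) \<Rightarrow> bool" where
  "convolutionary_sequence E d X \<longleftrightarrow>
     (\<forall>n\<ge>1. \<forall>k\<in>{1..n}. of_convolution E d (X (Suc n)) (\<lambda>\<omega> j. \<Sum>i=k..n. X i \<omega> j))"

end

theory Submission imports Defs begin

text \<open>
  The independent copy is the coordinate process on the space of sequences \<open>\<xi>\<close> of vectors, and its
  sublinear expectation is an iterated one: integrate out the last block \<open>\<xi> n\<close> of a function of
  \<open>\<xi> 1, \<dots>, \<xi> n\<close> with the law of \<open>X n\<close>, then \<open>\<xi> (n - 1)\<close> with the law of \<open>X (n - 1)\<close>, and so on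
  down to \<open>\<xi> 1\<close>. Since integrating out a block on which a function does not depend does not change
  it, the result does not depend on the choice of \<open>n\<close> (\<open>prod_E_eq\<close>). Independence of the next block
  from its predecessors is then the first step of this recursion (\<open>prod_E_integrate_last\<close>).

  The sums agree by induction on their length, for all test functions at once
  (\<open>expectation_sum_eq\<close>). For the original sequence the convolution property, and for the
  coordinate process the recursion, replaces \<open>\<phi>\<close> of the longer sum by \<open>\<psi>\<close> of the shorter sum,
  where \<open>\<psi> x = \<bbbE>[\<phi>(x + X\<^sub>n)]\<close> for the index \<open>n\<close> of the last summand. The function \<open>\<psi>\<close> is the same
  on both sides because it only involves the law of one summand.

  Both parts need the class of test functions to be stable under taking the expectation in some of
  the variables: the local Lipschitz constant of the integrand grows polynomially in the variable
  that is integrated, so its expectation is finite (\<open>partial_expectation_poly_lip\<close>). They also need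
  stability under composition (\<open>poly_lip_compose\<close>). For both purposes the Euclidean norm is replaced
  by the sum of absolute coordinates, and the growth factor \<open>1 + \<bar>x\<bar>\<^sup>m + \<bar>y\<bar>\<^sup>m\<close> by a power of a product
  of weights, which is submultiplicative when variables are joined. Coordinates may be arbitrary
  functions on an arbitrary type, so that functions on \<open>\<real>\<^sup>n\<close>, on products and on the space of
  sequences are instances of one notion.
\<close>

section \<open>Locally Lipschitz functions of polynomial growth\<close>

definition weight :: "'a set \<Rightarrow> ('a \<Rightarrow> 'x \<Rightarrow> real) \<Rightarrow> 'x \<Rightarrow> real" where
  "weight A c x = 1 + (\<Sum>a\<in>A. \<bar>c a x\<bar>)"

definition gap :: "'a set \<Rightarrow> ('a \<Rightarrow> 'x \<Rightarrow> real) \<Rightarrow> 'x \<Rightarrow> 'x \<Rightarrow> real" where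
  "gap A c x y = (\<Sum>a\<in>A. \<bar>c a x - c a y\<bar>)"

definition poly_lip :: "'a set \<Rightarrow> ('a \<Rightarrow> 'x \<Rightarrow> real) \<Rightarrow> ('x \<Rightarrow> real) set" where
  "poly_lip A c = {f. \<exists>C\<ge>0. \<exists>m. \<forall>x y.
     \<bar>f x - f y\<bar> \<le> C * (weight A c x * weight A c y) ^ m * gap A c x y}"

lemma weight_ge_1: "1 \<le> weight A c x"
  by (simp add: weight_def sum_nonneg)

lemma weight_prod_ge_1: "1 \<le> weight A c x * weight A c y"
  using mult_mono[OF weight_ge_1[of A c x] weight_ge_1[of A c y]] weight_ge_1[of A c x] by simp

lemma gap_nonneg: "0 \<le> gap A c x y"
  by (simp add: gap_def sum_nonneg)

lemma weight_le_weight_add_gap: "weight A c x \<le> weight A c y + gap A c x y"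
proof -
  have "(\<Sum>a\<in>A. \<bar>c a x\<bar>) \<le> (\<Sum>a\<in>A. \<bar>c a y\<bar> + \<bar>c a x - c a y\<bar>)"
    by (rule sum_mono) linarith
  then show ?thesis by (simp add: weight_def gap_def sum.distrib)
qed

lemma gap_commute: "gap A c x y = gap A c y x"
  by (simp add: gap_def abs_minus_commute)

lemma gap_le_weight_prod: "gap A c x y \<le> 2 * (weight A c x * weight A c y)"
proof -
  have "gap A c x y \<le> (\<Sum>a\<in>A. \<bar>c a x\<bar> + \<bar>c a y\<bar>)"
    unfolding gap_def by (rule sum_mono) linarith
  also have "\<dots> \<le> weight A c x + weight A c y"
    by (simp add: weight_def sum.distrib)
  also have "\<dots> \<le> 2 * (weight A c x * weight A c y)"
    using mult_right_mono[OF weight_ge_1[of A c x], of "weight A c y"]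
      mult_left_mono[OF weight_ge_1[of A c y], of "weight A c x"]
      weight_ge_1[of A c x] weight_ge_1[of A c y]
    by linarith
  finally show ?thesis .
qed

lemma poly_lipI:
  assumes "0 \<le> C"
    and "\<And>x y. \<bar>f x - f y\<bar> \<le> C * (weight A c x * weight A c y) ^ m * gap A c x y"
  shows "f \<in> poly_lip A c"
  using assms unfolding poly_lip_def by blast

lemma poly_lipE:
  assumes "f \<in> poly_lip A c"
  obtains C m where "0 \<le> C"
    and "\<And>x y. \<bar>f x - f y\<bar> \<le> C * (weight A c x * weight A c y) ^ m * gap A c x y"
  using assms unfolding poly_lip_def by blast

text \<open>
  A function in the class depends on the listed coordinates only, which is what makes cylinder
  functions out of it.
\<close>

lemma poly_lip_eqI:
  assumes "f \<in> poly_lip A c" and "\<And>a. a \<in> A \<Longrightarrow> c a x = c a y"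
  shows "f x = f y"
proof -
  obtain C m where "\<bar>f x - f y\<bar> \<le> C * (weight A c x * weight A c y) ^ m * gap A c x y"
    using assms(1) by (rule poly_lipE) blast
  moreover have "gap A c x y = 0"
    using assms(2) by (simp add: gap_def)
  ultimately show ?thesis by simp
qed

lemma const_poly_lip: "(\<lambda>_. r) \<in> poly_lip A c"
  by (rule poly_lipI[where C = 0 and m = 0]) simp_all

lemma coord_poly_lip:
  assumes "finite A" "a \<in> A"
  shows "c a \<in> poly_lip A c"
  using assms member_le_sum[of a A "\<lambda>a. \<bar>c a x - c a y\<bar>" for x y]
  by (intro poly_lipI[where C = 1 and m = 0]) (auto simp: gap_def)

lemma vector_coord_poly_lip: "(\<lambda>x. x j) \<in> poly_lip {..<n} (\<lambda>j x. x j)" if "j < n" for j n :: nat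
  using that coord_poly_lip[of "{..<n}" j "\<lambda>j x. x j"] by simp

lemma add_poly_lip:
  assumes "f \<in> poly_lip A c" "g \<in> poly_lip A c"
  shows "(\<lambda>x. f x + g x) \<in> poly_lip A c"
proof -
  obtain C m where C: "0 \<le> C"
    and f: "\<And>x y. \<bar>f x - f y\<bar> \<le> C * (weight A c x * weight A c y) ^ m * gap A c x y"
    using assms(1) by (rule poly_lipE) blast
  obtain D k where D: "0 \<le> D"
    and g: "\<And>x y. \<bar>g x - g y\<bar> \<le> D * (weight A c x * weight A c y) ^ k * gap A c x y"
    using assms(2) by (rule poly_lipE) blast
  show ?thesis
  proof (rule poly_lipI[where C = "C + D" and m = "m + k"])
    fix x y
    let ?w = "weight A c x * weight A c y"
    have "C * ?w ^ m * gap A c x y \<le> C * ?w ^ (m + k) * gap A c x y"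
      "D * ?w ^ k * gap A c x y \<le> D * ?w ^ (m + k) * gap A c x y"
      using C D weight_prod_ge_1[of A c x y] gap_nonneg[of A c x y]
      by (auto intro!: mult_right_mono mult_left_mono power_increasing)
    then show "\<bar>f x + g x - (f y + g y)\<bar> \<le> (C + D) * ?w ^ (m + k) * gap A c x y"
      using f[of x y] g[of x y] by (simp add: algebra_simps)
  qed (use C D in simp)
qed

lemma sum_poly_lip:
  assumes "\<And>i. i \<in> I \<Longrightarrow> f i \<in> poly_lip A c"
  shows "(\<lambda>x. \<Sum>i\<in>I. f i x) \<in> poly_lip A c"
  using assms by (induction I rule: infinite_finite_induct) (auto intro: const_poly_lip add_poly_lip)

lemma scale_poly_lip:
  assumes "f \<in> poly_lip A c"
  shows "(\<lambda>x. r * f x) \<in> poly_lip A c"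
proof -
  obtain C m where C: "0 \<le> C"
    and f: "\<And>x y. \<bar>f x - f y\<bar> \<le> C * (weight A c x * weight A c y) ^ m * gap A c x y"
    using assms by (rule poly_lipE) blast
  show ?thesis
  proof (rule poly_lipI[where C = "\<bar>r\<bar> * C" and m = m])
    fix x y
    have "\<bar>r * f x - r * f y\<bar> = \<bar>r\<bar> * \<bar>f x - f y\<bar>"
      by (simp add: abs_mult flip: right_diff_distrib)
    then show "\<bar>r * f x - r * f y\<bar>
        \<le> \<bar>r\<bar> * C * (weight A c x * weight A c y) ^ m * gap A c x y"
      using mult_left_mono[OF f[of x y], of "\<bar>r\<bar>"] by (simp add: mult.assoc)
  qed (use C in simp)
qed

text \<open>
  Powers of the weight have a finite expectation at a random vector because they are themselves
  admissible test functions; these are the moment bounds used for partial expectations.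
\<close>

lemma weight_power_poly_lip: "(\<lambda>x. weight A c x ^ k) \<in> poly_lip A c"
proof (rule poly_lipI[where C = "real k" and m = k])
  fix x y
  let ?a = "weight A c x" and ?b = "weight A c y"
  have ab: "\<bar>?a - ?b\<bar> \<le> gap A c x y"
    using weight_le_weight_add_gap[of A c x y] weight_le_weight_add_gap[of A c y x]
    by (simp add: gap_commute abs_le_iff)
  have a: "1 \<le> ?a" and b: "1 \<le> ?b" by (simp_all add: weight_ge_1)
  show "\<bar>?a ^ k - ?b ^ k\<bar> \<le> real k * (?a * ?b) ^ k * gap A c x y"
  proof (induction k)
    case (Suc k)
    have one: "1 \<le> ?b ^ Suc k" "1 \<le> ?a ^ Suc k"
      using a b by (auto intro!: one_le_power simp del: power_Suc)
    have "?a ^ k \<le> ?a ^ Suc k" by (rule power_increasing) (use a in auto)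
    also have "\<dots> \<le> (?a * ?b) ^ Suc k"
      using mult_left_mono[OF one(1), of "?a ^ Suc k"] a
      by (simp add: power_mult_distrib del: power_Suc)
    finally have pa: "?a ^ k \<le> (?a * ?b) ^ Suc k" .
    have "?b * (?a * ?b) ^ k \<le> ?a * ?b * (?a * ?b) ^ k"
      using a b mult_right_mono[OF a, of "?b"] by (intro mult_right_mono) auto
    then have pb: "?b * (?a * ?b) ^ k \<le> (?a * ?b) ^ Suc k" by simp
    \<comment> \<open>Telescoping: one factor is changed from \<open>b\<close> to \<open>a\<close> at a time; weights are at least 1, so
      exponents may be raised freely.\<close>
    have "?a ^ Suc k - ?b ^ Suc k = ?a ^ k * (?a - ?b) + ?b * (?a ^ k - ?b ^ k)"
      by (simp add: algebra_simps)
    then have "\<bar>?a ^ Suc k - ?b ^ Suc k\<bar> \<le> ?a ^ k * \<bar>?a - ?b\<bar> + ?b * \<bar>?a ^ k - ?b ^ k\<bar>"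
      using a b abs_triangle_ineq[of "?a ^ k * (?a - ?b)" "?b * (?a ^ k - ?b ^ k)"]
      by (simp add: abs_mult del: power_Suc)
    also have "\<dots> \<le> (?a * ?b) ^ Suc k * gap A c x y
        + ?b * (real k * (?a * ?b) ^ k * gap A c x y)"
      using pa ab Suc.IH a b by (intro add_mono mult_mono mult_left_mono) auto
    also have "?b * (real k * (?a * ?b) ^ k * gap A c x y)
        = real k * (?b * (?a * ?b) ^ k) * gap A c x y"
      by simp
    also have "\<dots> \<le> real k * (?a * ?b) ^ Suc k * gap A c x y"
      using pb by (intro mult_right_mono mult_left_mono) (auto simp: gap_nonneg)
    finally show ?case by (simp add: algebra_simps)
  qed simp
qed simp

text \<open>
  The Euclidean norm and the sum of absolute coordinates are equivalent, with constants that depend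
  on \<open>n\<close>. In one direction \<open>1 + a\<^sup>m + b\<^sup>m \<le> 3 ((1 + a) (1 + b))\<^sup>m\<close>; in the other a product of two
  weights is at most a multiple of the square of the largest of 1 and the two norms, which doubles
  the exponent.
\<close>

lemma C_l_Lip_eq_poly_lip: "C_l_Lip n = poly_lip {..<n} (\<lambda>j x. x j)"
proof (intro set_eqI iffI)
  fix f
  let ?W = "weight {..<n} (\<lambda>j x. x j)" and ?D = "gap {..<n} (\<lambda>j x. x j)"
  assume "f \<in> C_l_Lip n"
  then obtain C m where C: "0 < C" and f: "\<And>x y. \<bar>f x - f y\<bar>
      \<le> C * (1 + enorm n x ^ m + enorm n y ^ m) * edist n x y"
    unfolding C_l_Lip_def by blast
  show "f \<in> poly_lip {..<n} (\<lambda>j x. x j)"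
  proof (rule poly_lipI[where C = "3 * C" and m = m])
    fix x y
    have en: "0 \<le> enorm n z" "enorm n z \<le> ?W z" for z
      using L2_set_le_sum_abs[of z "{..<n}"] by (auto simp: enorm_def weight_def)
    have ed: "edist n x y \<le> ?D x y" "0 \<le> edist n x y"
      using L2_set_le_sum_abs[of "\<lambda>j. x j - y j" "{..<n}"]
      by (auto simp: edist_def enorm_def gap_def)
    have w1: "1 \<le> ?W z" for z by (rule weight_ge_1)
    have p1: "1 \<le> ?W z ^ m" for z by (rule one_le_power[OF w1])
    have "enorm n x ^ m \<le> ?W x ^ m" "enorm n y ^ m \<le> ?W y ^ m"
      using en by (auto intro: power_mono)
    moreover have "?W x ^ m \<le> (?W x * ?W y) ^ m" "?W y ^ m \<le> (?W x * ?W y) ^ m"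
      "1 \<le> (?W x * ?W y) ^ m"
      using mult_left_mono[OF p1[of y], of "?W x ^ m"] mult_right_mono[OF p1[of x], of "?W y ^ m"]
        p1[of x] p1[of y] one_le_power[OF weight_prod_ge_1]
      by (auto simp: power_mult_distrib)
    ultimately have "1 + enorm n x ^ m + enorm n y ^ m \<le> 3 * (?W x * ?W y) ^ m" by linarith
    then have "C * (1 + enorm n x ^ m + enorm n y ^ m) * edist n x y
        \<le> C * (3 * (?W x * ?W y) ^ m) * ?D x y"
      using C ed weight_prod_ge_1[of "{..<n}" "\<lambda>j x. x j" x y]
      by (intro mult_mono mult_left_mono) auto
    with f[of x y] show "\<bar>f x - f y\<bar> \<le> 3 * C * (?W x * ?W y) ^ m * ?D x y"
      by simp
  qed (use C in simp)
next
  fix f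
  let ?W = "weight {..<n} (\<lambda>j x. x j)" and ?D = "gap {..<n} (\<lambda>j x. x j)"
  assume "f \<in> poly_lip {..<n} (\<lambda>j x. x j)"
  then obtain C m where C: "0 \<le> C"
    and f: "\<And>x y. \<bar>f x - f y\<bar> \<le> C * (?W x * ?W y) ^ m * ?D x y"
    by (rule poly_lipE) blast
  have sum_le: "(\<Sum>j<n. \<bar>z j\<bar>) \<le> real n * enorm n z" for z
  proof -
    have "\<bar>z j\<bar> \<le> enorm n z" if "j < n" for j
      using member_le_L2_set[of "{..<n}" j "\<lambda>j. \<bar>z j\<bar>"] that
      by (simp add: enorm_def L2_set_def)
    then show ?thesis
      using sum_bounded_above[of "{..<n}" "\<lambda>j. \<bar>z j\<bar>" "enorm n z"] by simp
  qed
  \<comment> \<open>A weight is at most \<open>N\<close> times the larger of 1 and the Euclidean norm.\<close>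
  define N where "N = real n + 1"
  have N: "1 \<le> N" by (simp add: N_def)
  have "\<bar>f x - f y\<bar> \<le> (C * N ^ (2 * m) * real n + 1)
      * (1 + enorm n x ^ (2 * m) + enorm n y ^ (2 * m)) * edist n x y" for x y
  proof -
    define M where "M = max 1 (max (enorm n x) (enorm n y))"
    have M: "1 \<le> M" "enorm n x \<le> M" "enorm n y \<le> M" by (auto simp: M_def)
    have en: "0 \<le> enorm n z" for z by (simp add: enorm_def)
    have W: "?W z \<le> N * M" if "enorm n z \<le> M" for z
    proof -
      have "real n * enorm n z \<le> real n * M"
        using that by (simp add: mult_left_mono)
      with sum_le[of z] have "?W z \<le> 1 + real n * M" by (simp add: weight_def)
      also have "\<dots> \<le> N * M" using M(1) mult_left_mono[OF M(1), of "real n"]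
        by (simp add: N_def algebra_simps)
      finally show ?thesis .
    qed
    have w0: "0 \<le> ?W z" for z using weight_ge_1[of "{..<n}" "\<lambda>j x. x j" z] by simp
    have "?W x * ?W y \<le> (N * M) * (N * M)"
      using W M N w0 by (intro mult_mono) auto
    then have "(?W x * ?W y) ^ m \<le> (N * M * (N * M)) ^ m"
      using w0 by (intro power_mono) auto
    also have "\<dots> = N ^ (2 * m) * M ^ (2 * m)"
      by (simp add: power_mult_distrib power_mult power2_eq_square ac_simps)
    also have "M ^ (2 * m) \<le> 1 + enorm n x ^ (2 * m) + enorm n y ^ (2 * m)"
      using en by (auto simp: M_def max_def)
    finally have a: "(?W x * ?W y) ^ m
        \<le> N ^ (2 * m) * (1 + enorm n x ^ (2 * m) + enorm n y ^ (2 * m))"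
      using N by simp
    have b: "?D x y \<le> real n * edist n x y"
      using sum_le[of "\<lambda>j. x j - y j"] by (simp add: gap_def edist_def)
    have e0: "0 \<le> edist n x y" using en by (simp add: edist_def)
    have "\<bar>f x - f y\<bar> \<le> C * (?W x * ?W y) ^ m * ?D x y" by (rule f)
    also have "\<dots> \<le> C * (N ^ (2 * m) * (1 + enorm n x ^ (2 * m) + enorm n y ^ (2 * m)))
        * (real n * edist n x y)"
      using C a b w0 en N gap_nonneg by (intro mult_mono mult_left_mono) auto
    also have "\<dots> = (C * N ^ (2 * m) * real n)
      * (1 + enorm n x ^ (2 * m) + enorm n y ^ (2 * m)) * edist n x y" by simp
    also have "\<dots> \<le> (C * N ^ (2 * m) * real n + 1)
      * (1 + enorm n x ^ (2 * m) + enorm n y ^ (2 * m)) * edist n x y"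
      using e0 en by (intro mult_right_mono) auto
    finally show ?thesis .
  qed
  moreover have "0 < C * N ^ (2 * m) * real n + 1"
    using C N by (simp add: add_nonneg_pos)
  ultimately show "f \<in> C_l_Lip n" unfolding C_l_Lip_def by blast
qed

lemma C_b_Lip_subset_C_l_Lip: "C_b_Lip n \<subseteq> C_l_Lip n"
proof
  fix f assume "f \<in> C_b_Lip n"
  then obtain L where L: "\<And>x y. \<bar>f x - f y\<bar> \<le> L * edist n x y"
    unfolding C_b_Lip_def by blast
  have "\<bar>f x - f y\<bar> \<le> (\<bar>L\<bar> + 1) * (1 + enorm n x ^ 0 + enorm n y ^ 0) * edist n x y" for x y
  proof -
    have "L * edist n x y \<le> ((\<bar>L\<bar> + 1) * 3) * edist n x y"
      by (intro mult_right_mono) (auto simp: edist_def enorm_def)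
    then show ?thesis using L[of x y] by simp
  qed
  then show "f \<in> C_l_Lip n"
    unfolding C_l_Lip_def by (intro CollectI exI[of _ "\<bar>L\<bar> + 1"]) (auto intro!: exI[of _ 0])
qed

text \<open>
  The class is closed under composition because its growth is polynomial: the coordinates of \<open>h\<close>
  are locally Lipschitz of polynomial growth, hence the weight of \<open>h x\<close> is at most a multiple of a
  power of the weight of \<open>x\<close>, and powers of powers are powers.
\<close>

lemma poly_lip_compose:
  assumes f: "f \<in> poly_lip B b" and h: "\<And>i. i \<in> B \<Longrightarrow> (\<lambda>x. b i (h x)) \<in> poly_lip A c"
  shows "(\<lambda>x. f (h x)) \<in> poly_lip A c"
proof -
  have "\<exists>C\<ge>0. \<exists>m. \<forall>x y. gap B b (h x) (h y)
      \<le> C * (weight A c x * weight A c y) ^ m * gap A c x y"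
    using h
  proof (induction B rule: infinite_finite_induct)
    case (insert i B)
    then obtain C m where C: "0 \<le> C" and g: "\<And>x y. gap B b (h x) (h y)
      \<le> C * (weight A c x * weight A c y) ^ m * gap A c x y" by blast
    from insert.prems[of i] obtain D k where D: "0 \<le> D" and i: "\<And>x y. \<bar>b i (h x) - b i (h y)\<bar>
        \<le> D * (weight A c x * weight A c y) ^ k * gap A c x y"
      by (meson insertI1 poly_lipE)
    have "gap (insert i B) b (h x) (h y)
        \<le> (C + D) * (weight A c x * weight A c y) ^ (m + k) * gap A c x y" for x y
    proof -
      let ?w = "weight A c x * weight A c y"
      have "C * ?w ^ m * gap A c x y \<le> C * ?w ^ (m + k) * gap A c x y"
        "D * ?w ^ k * gap A c x y \<le> D * ?w ^ (m + k) * gap A c x y"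
        using C D weight_prod_ge_1[of A c x y] gap_nonneg[of A c x y]
        by (auto intro!: mult_right_mono mult_left_mono power_increasing)
      moreover have "gap (insert i B) b (h x) (h y) = \<bar>b i (h x) - b i (h y)\<bar> + gap B b (h x) (h y)"
        using insert.hyps by (simp add: gap_def)
      ultimately show ?thesis
        using g[of x y] i[of x y] by (simp add: algebra_simps)
    qed
    then show ?case using C D by (intro exI[of _ "C + D"] exI[of _ "m + k"] conjI allI) auto
  qed (auto simp: gap_def intro!: exI[of _ 0])
  then obtain D k where D: "0 \<le> D" and gap_h: "\<And>x y. gap B b (h x) (h y)
      \<le> D * (weight A c x * weight A c y) ^ k * gap A c x y"
    by blast
  obtain K where K: "0 \<le> K" and weight_h: "\<And>x. weight B b (h x) \<le> K * weight A c x ^ Suc k"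
  proof -
    \<comment> \<open>Any base point \<open>z\<close> will do: the growth of \<open>h\<close> follows by comparing \<open>h x\<close> with \<open>h z\<close>.\<close>
    fix z :: 'c
    let ?w = "weight A c" and ?v = "weight B b (h z)"
    have "weight B b (h x) \<le> (?v + 2 * D * ?w z ^ Suc k) * ?w x ^ Suc k" for x
    proof -
      have "weight B b (h x) \<le> ?v + gap B b (h x) (h z)"
        by (rule weight_le_weight_add_gap)
      also have "gap B b (h x) (h z) \<le> D * (?w x * ?w z) ^ k * gap A c x z"
        by (rule gap_h)
      also have "\<dots> \<le> D * (?w x * ?w z) ^ k * (2 * (?w x * ?w z))"
        using D weight_prod_ge_1[of A c x z] gap_le_weight_prod[of A c x z]
        by (intro mult_left_mono) auto
      also have "\<dots> = 2 * D * ?w z ^ Suc k * ?w x ^ Suc k"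
        by (simp add: power_mult_distrib ac_simps)
      also have "?v \<le> ?v * ?w x ^ Suc k"
        using weight_ge_1[of B b "h z"] one_le_power[OF weight_ge_1[of A c x], of "Suc k"]
          mult_left_mono[of 1 "?w x ^ Suc k" ?v]
        by (simp del: power_Suc)
      finally show ?thesis by (simp add: algebra_simps)
    qed
    moreover have "0 \<le> ?v + 2 * D * ?w z ^ Suc k"
      using D weight_ge_1[of B b "h z"] weight_ge_1[of A c z] by simp
    ultimately show thesis using that by blast
  qed
  obtain C m where C: "0 \<le> C"
    and f: "\<And>x y. \<bar>f x - f y\<bar> \<le> C * (weight B b x * weight B b y) ^ m * gap B b x y"
    using f by (rule poly_lipE) blast
  show ?thesis
  proof (rule poly_lipI[where C = "C * (K * K) ^ m * D" and m = "Suc k * m + k"])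
    fix x y
    let ?p = "weight A c x * weight A c y"
    have p: "0 \<le> ?p" using weight_prod_ge_1[of A c x y] by simp
    have w0: "0 \<le> weight A c z" "0 \<le> weight B b z'" for z z'
      using weight_ge_1[of A c z] weight_ge_1[of B b z'] by simp_all
    have "weight B b (h x) * weight B b (h y)
        \<le> (K * weight A c x ^ Suc k) * (K * weight A c y ^ Suc k)"
      using weight_h w0 K by (intro mult_mono) auto
    then have "(weight B b (h x) * weight B b (h y)) ^ m
        \<le> ((K * weight A c x ^ Suc k) * (K * weight A c y ^ Suc k)) ^ m"
      using w0 by (intro power_mono) auto
    also have "(K * weight A c x ^ Suc k) * (K * weight A c y ^ Suc k) = K * K * ?p ^ Suc k"
      by (simp add: power_mult_distrib ac_simps)
    also have "\<dots> ^ m = (K * K) ^ m * ?p ^ (Suc k * m)"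
      by (simp only: power_mult_distrib power_mult)
    finally have wm: "(weight B b (h x) * weight B b (h y)) ^ m
        \<le> (K * K) ^ m * ?p ^ (Suc k * m)" .
    have "\<bar>f (h x) - f (h y)\<bar>
        \<le> C * (weight B b (h x) * weight B b (h y)) ^ m * gap B b (h x) (h y)"
      by (rule f)
    also have "\<dots> \<le> C * ((K * K) ^ m * ?p ^ (Suc k * m)) * (D * ?p ^ k * gap A c x y)"
      using wm gap_h C w0 K p by (intro mult_mono mult_left_mono) (auto simp: gap_nonneg)
    also have "\<dots> = C * (K * K) ^ m * D * ?p ^ (Suc k * m + k) * gap A c x y"
      by (simp only: power_add ac_simps)
    finally show "\<bar>f (h x) - f (h y)\<bar>
        \<le> C * (K * K) ^ m * D * ?p ^ (Suc k * m + k) * gap A c x y" .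
  qed (use C D K in simp)
qed

section \<open>Partial expectation\<close>

text \<open>
  The coordinates of a point \<open>(x, y)\<close>, those of \<open>x\<close> being given by \<open>c\<close>, so that a function in
  \<open>poly_lip (A <+> {..<d}) (pair_coord c)\<close> is jointly controlled in \<open>x\<close> and in \<open>y \<in> \<real>\<^sup>d\<close>.
\<close>

definition pair_coord :: "('a \<Rightarrow> 'x \<Rightarrow> real) \<Rightarrow> 'a + nat \<Rightarrow> 'x \<times> (nat \<Rightarrow> real) \<Rightarrow> real" where
  "pair_coord c i p = (case i of Inl a \<Rightarrow> c a (fst p) | Inr j \<Rightarrow> snd p j)"

lemma pair_coord_simps [simp]:
  "pair_coord c (Inl a) p = c a (fst p)" "pair_coord c (Inr j) p = snd p j"
  by (simp_all add: pair_coord_def)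

context sublinear_expectation_space
begin

lemma random_vector_comp_mem:
  assumes "1 \<le> d" "random_vector H d Y" "\<phi> \<in> C_l_Lip d"
  shows "(\<lambda>\<omega>. \<phi> (Y \<omega>)) \<in> H"
  using closed[of d "\<lambda>j \<omega>. Y \<omega> j" \<phi>] assms by (simp add: random_vector_def)

lemma add_scaled_mem:
  assumes "U \<in> H" "V \<in> H"
  shows "(\<lambda>\<omega>. U \<omega> + r * V \<omega>) \<in> H"
proof -
  have "(\<lambda>x. x 0 + r * x (Suc 0)) \<in> C_l_Lip 2"
    unfolding C_l_Lip_eq_poly_lip
    by (intro add_poly_lip scale_poly_lip vector_coord_poly_lip) simp_all
  from closed[OF _ _ this, of "\<lambda>j. if j = 0 then U else V"] assms show ?thesis by simp
qed

text \<open>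
  Sublinearity in the form in which it yields Lipschitz estimates: with the roles of \<open>U\<close> and \<open>V\<close>
  exchanged it bounds \<open>\<bar>E U - E V\<bar>\<close> by \<open>r * E Z\<close>.
\<close>

lemma expectation_le_add:
  assumes "U \<in> H" "V \<in> H" "Z \<in> H" "0 \<le> r" and le: "\<And>\<omega>. U \<omega> \<le> V \<omega> + r * Z \<omega>"
  shows "E U \<le> E V + r * E Z"
proof -
  have Z: "(\<lambda>\<omega>. r * Z \<omega>) \<in> H"
    using add_scaled_mem[OF const_mem[of 0] assms(3), of r] by simp
  have "E U \<le> E (\<lambda>\<omega>. V \<omega> + r * Z \<omega>)"
    using assms add_scaled_mem by (intro mono) auto
  also have "\<dots> \<le> E V + E (\<lambda>\<omega>. r * Z \<omega>)"
    using assms Z by (intro subadd) auto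
  finally show ?thesis using pos_homogeneous assms by simp
qed

lemma section_mem:
  assumes "1 \<le> d" "random_vector H d Y" "finite A"
    and "F \<in> poly_lip (A <+> {..<d}) (pair_coord c)"
  shows "(\<lambda>\<omega>. F (x, Y \<omega>)) \<in> H"
proof -
  have "(\<lambda>y. F (x, y)) \<in> C_l_Lip d"
    unfolding C_l_Lip_eq_poly_lip using assms(4)
  proof (rule poly_lip_compose)
    fix i assume "i \<in> A <+> {..<d}"
    then show "(\<lambda>y. pair_coord c i (x, y)) \<in> poly_lip {..<d} (\<lambda>j x. x j)"
      by (cases i) (auto simp: const_poly_lip vector_coord_poly_lip)
  qed
  then show ?thesis using random_vector_comp_mem assms by blast
qed

text \<open>
  The weight of \<open>(x, y)\<close> is at most the product of the weights of \<open>x\<close> and of \<open>y\<close>. Hence \<open>F (x, y)\<close> and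
  \<open>F (x', y)\<close> differ by at most a Lipschitz estimate in \<open>x\<close>, \<open>x'\<close> alone times the power \<open>2 m\<close> of the
  weight of \<open>y\<close>, whose expectation at \<open>Y\<close> is a finite constant \<open>K\<close>.
\<close>

lemma partial_expectation_poly_lip:
  assumes d: "1 \<le> d" and Y: "random_vector H d Y" and A: "finite A"
    and F: "F \<in> poly_lip (A <+> {..<d}) (pair_coord c)"
  shows "(\<lambda>x. E (\<lambda>\<omega>. F (x, Y \<omega>))) \<in> poly_lip A c"
proof -
  let ?V = "weight {..<d} (\<lambda>j x. x j)"
  let ?W = "weight (A <+> {..<d}) (pair_coord c)"
  obtain C m where C: "0 \<le> C" and F_le: "\<And>p q. \<bar>F p - F q\<bar>
      \<le> C * (?W p * ?W q) ^ m * gap (A <+> {..<d}) (pair_coord c) p q"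
    using F by (rule poly_lipE) blast
  have V: "(\<lambda>\<omega>. ?V (Y \<omega>) ^ (2 * m)) \<in> H"
    by (rule random_vector_comp_mem[OF d Y]) (simp only: C_l_Lip_eq_poly_lip weight_power_poly_lip)
  define K where "K = E (\<lambda>\<omega>. ?V (Y \<omega>) ^ (2 * m))"
  have V1: "1 \<le> ?V y" for y by (rule weight_ge_1)
  have W1: "1 \<le> weight A c x" for x by (rule weight_ge_1)
  have "1 \<le> K"
    unfolding K_def using mono[OF V const_mem[of 1]] V1 const[of 1] by (auto intro: one_le_power)
  have W: "?W (x, y) \<le> weight A c x * ?V y" for x y
  proof -
    have "?W (x, y) = weight A c x + (?V y - 1)"
      using A by (simp add: weight_def sum.Plus)
    also have "?V y - 1 \<le> weight A c x * (?V y - 1)"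
      using mult_right_mono[OF W1, of "?V y - 1" x] V1[of y] by simp
    finally show ?thesis by (simp add: algebra_simps)
  qed
  have one_sided: "E (\<lambda>\<omega>. F (x, Y \<omega>)) \<le> E (\<lambda>\<omega>. F (x', Y \<omega>))
      + C * (weight A c x * weight A c x') ^ m * gap A c x x' * K" for x x'
    unfolding K_def
  proof (rule expectation_le_add)
    fix \<omega>
    let ?y = "Y \<omega>"
    have W0: "0 \<le> ?W p" for p
      by (rule order_trans[OF zero_le_one weight_ge_1])
    have "0 \<le> weight A c x * ?V ?y"
      using V1[of ?y] W1[of x] by simp
    then have "?W (x, ?y) * ?W (x', ?y) \<le> (weight A c x * ?V ?y) * (weight A c x' * ?V ?y)"
      using W0 by (intro mult_mono W)
    then have "(?W (x, ?y) * ?W (x', ?y)) ^ m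
        \<le> ((weight A c x * ?V ?y) * (weight A c x' * ?V ?y)) ^ m"
      using W0 by (intro power_mono) auto
    also have "\<dots> = (weight A c x * weight A c x') ^ m * ?V ?y ^ (2 * m)"
      by (simp add: power_mult_distrib power_mult power2_eq_square ac_simps)
    finally have w: "(?W (x, ?y) * ?W (x', ?y)) ^ m
      \<le> (weight A c x * weight A c x') ^ m * ?V ?y ^ (2 * m)" .
    have g: "gap (A <+> {..<d}) (pair_coord c) (x, ?y) (x', ?y) = gap A c x x'"
      using A by (simp add: gap_def sum.Plus)
    have "F (x, ?y) - F (x', ?y) \<le> C * (?W (x, ?y) * ?W (x', ?y)) ^ m * gap A c x x'"
      using F_le[of "(x, ?y)" "(x', ?y)"] by (simp add: g)
    also have "\<dots> \<le> C * ((weight A c x * weight A c x') ^ m * ?V ?y ^ (2 * m)) * gap A c x x'"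
      using w C gap_nonneg by (intro mult_right_mono mult_left_mono) auto
    finally show "F (x, ?y) \<le> F (x', ?y)
        + C * (weight A c x * weight A c x') ^ m * gap A c x x' * ?V ?y ^ (2 * m)"
      by (simp add: ac_simps)
  next
    show "0 \<le> C * (weight A c x * weight A c x') ^ m * gap A c x x'"
      using C gap_nonneg[of A c x x'] weight_prod_ge_1[of A c x x'] by simp
  qed (use V section_mem[OF d Y A F] in auto)
  show ?thesis
  proof (rule poly_lipI[where C = "C * K" and m = m])
    fix x y
    show "\<bar>E (\<lambda>\<omega>. F (x, Y \<omega>)) - E (\<lambda>\<omega>. F (y, Y \<omega>))\<bar>
        \<le> C * K * (weight A c x * weight A c y) ^ m * gap A c x y"
      using one_sided[of x y] one_sided[of y x]
      by (simp add: abs_le_iff gap_commute[of A c y x] ac_simps)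
  qed (use C \<open>1 \<le> K\<close> in simp)
qed

end

section \<open>The product space\<close>

text \<open>
  Functions of the first \<open>n\<close> blocks of a sequence of \<open>d\<close>-dimensional vectors. Blocks are counted
  from 1, like the random vectors that they stand for.
\<close>

definition cyl :: "nat \<Rightarrow> nat \<Rightarrow> ((nat \<Rightarrow> nat \<Rightarrow> real) \<Rightarrow> real) set" where
  "cyl d n = poly_lip ({1..n} \<times> {..<d}) (\<lambda>(i, j) \<xi>. \<xi> i j)"

lemma coord_cyl: "i \<in> {1..n} \<Longrightarrow> j < d \<Longrightarrow> (\<lambda>\<xi>. \<xi> i j) \<in> cyl d n"
  using coord_poly_lip[of "{1..n} \<times> {..<d}" "(i, j)" "\<lambda>(i, j) \<xi>. \<xi> i j"] by (simp add: cyl_def)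

lemma const_cyl: "(\<lambda>_. r) \<in> cyl d n"
  by (simp add: cyl_def const_poly_lip)

lemma cyl_compose:
  assumes "f \<in> poly_lip B b" "\<And>i. i \<in> B \<Longrightarrow> (\<lambda>\<xi>. b i (h \<xi>)) \<in> cyl d n"
  shows "(\<lambda>\<xi>. f (h \<xi>)) \<in> cyl d n"
  using assms unfolding cyl_def by (rule poly_lip_compose)

lemma cyl_compose_vector:
  assumes "\<phi> \<in> C_l_Lip k" "\<And>j. j < k \<Longrightarrow> (\<lambda>\<xi>. h \<xi> j) \<in> cyl d n"
  shows "(\<lambda>\<xi>. \<phi> (h \<xi>)) \<in> cyl d n"
  using assms(1) unfolding C_l_Lip_eq_poly_lip by (rule cyl_compose) (use assms(2) in simp)

lemma cyl_mono:
  assumes "f \<in> cyl d n" "n \<le> N"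
  shows "f \<in> cyl d N"
  using assms(1) unfolding cyl_def[of d n]
  by (rule cyl_compose) (use assms(2) in \<open>auto intro: coord_cyl\<close>)

lemma cyl_eqI:
  assumes "f \<in> cyl d n" "\<And>i j. i \<in> {1..n} \<Longrightarrow> j < d \<Longrightarrow> \<xi> i j = \<xi>' i j"
  shows "f \<xi> = f \<xi>'"
  using assms(1) unfolding cyl_def by (rule poly_lip_eqI) (use assms(2) in auto)

locale random_sequence = sublinear_expectation_space H E
  for H :: "('w \<Rightarrow> real) set" and E +
  fixes d :: nat and X :: "nat \<Rightarrow> 'w \<Rightarrow> nat \<Rightarrow> real"
  assumes dim: "1 \<le> d" and random: "1 \<le> i \<Longrightarrow> random_vector H d (X i)"
begin

definition integrate_out :: "nat \<Rightarrow> ((nat \<Rightarrow> nat \<Rightarrow> real) \<Rightarrow> real) \<Rightarrow> (nat \<Rightarrow> nat \<Rightarrow> real) \<Rightarrow> real" where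
  "integrate_out k f \<xi> = E (\<lambda>w. f (\<xi>(k := X k w)))"

text \<open>
  The last block is integrated out first. The value stays a function of the whole sequence, so that
  no choice of a representation of \<open>f\<close> by a function on \<open>\<real>\<^sup>n\<^sup>d\<close> is involved; for \<open>f \<in> cyl d n\<close> it is
  constant.
\<close>

primrec iterated :: "nat \<Rightarrow> ((nat \<Rightarrow> nat \<Rightarrow> real) \<Rightarrow> real) \<Rightarrow> (nat \<Rightarrow> nat \<Rightarrow> real) \<Rightarrow> real" where
  "iterated 0 f = f"
| "iterated (Suc n) f = iterated n (integrate_out (Suc n) f)"

definition prod_H :: "((nat \<Rightarrow> nat \<Rightarrow> real) \<Rightarrow> real) set" where
  "prod_H = (\<Union>n. cyl d n)"

text \<open>
  On \<open>prod_H\<close> every admissible choice of \<open>n\<close> gives the same value, by \<open>prod_E_eq\<close> below. The zero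
  sequence is an arbitrary point at which to evaluate the constant function \<open>iterated n f\<close>.
\<close>

definition prod_E :: "((nat \<Rightarrow> nat \<Rightarrow> real) \<Rightarrow> real) \<Rightarrow> real" where
  "prod_E f = iterated (SOME n. f \<in> cyl d n) f (\<lambda>_ _. 0)"

lemma update_poly_lip:
  assumes "f \<in> cyl d (Suc n)"
  shows "(\<lambda>(\<xi>, y). f (\<xi>(Suc n := y)))
    \<in> poly_lip (({1..n} \<times> {..<d}) <+> {..<d}) (pair_coord (\<lambda>(i, j) \<xi>. \<xi> i j))"
    (is "_ \<in> poly_lip ?B ?b")
proof -
  have "(\<lambda>p. f ((fst p)(Suc n := snd p))) \<in> poly_lip ?B ?b"
    using assms unfolding cyl_def
  proof (rule poly_lip_compose)
    fix a assume "a \<in> {1..Suc n} \<times> {..<d}"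
    then obtain i j where a: "a = (i, j)" "1 \<le> i" "i \<le> Suc n" "j < d" by auto
    show "(\<lambda>p. (case a of (i, j) \<Rightarrow> \<lambda>\<xi>. \<xi> i j) ((fst p)(Suc n := snd p))) \<in> poly_lip ?B ?b"
    proof (cases "i = Suc n")
      case True
      then show ?thesis
        using a coord_poly_lip[of ?B "Inr j" ?b] by (simp add: pair_coord_def[abs_def] InrI)
    next
      case False
      then show ?thesis
        using a coord_poly_lip[of ?B "Inl (i, j)" ?b] by (simp add: pair_coord_def[abs_def] InlI)
    qed
  qed
  then show ?thesis by (simp add: case_prod_beta')
qed

lemma update_mem:
  assumes "f \<in> cyl d (Suc n)"
  shows "(\<lambda>w. f (\<xi>(Suc n := X (Suc n) w))) \<in> H"
  using section_mem[OF dim random _ update_poly_lip[OF assms], of "Suc n" \<xi>] by simp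

lemma integrate_out_cyl:
  assumes "f \<in> cyl d (Suc n)"
  shows "integrate_out (Suc n) f \<in> cyl d n"
  using partial_expectation_poly_lip[OF dim random _ update_poly_lip[OF assms], of "Suc n"]
  by (simp add: cyl_def integrate_out_def[abs_def])

lemma integrate_out_absent:
  assumes "f \<in> cyl d n" "n < k"
  shows "integrate_out k f = f"
proof
  fix \<xi>
  have "f (\<xi>(k := y)) = f \<xi>" for y
    by (rule cyl_eqI[OF assms(1)]) (use assms(2) in auto)
  then show "integrate_out k f \<xi> = f \<xi>" by (simp add: integrate_out_def const)
qed

lemma iterated_stable:
  assumes "f \<in> cyl d n" "n \<le> N"
  shows "iterated N f = iterated n f"
  using assms(2)
proof (induction N rule: dec_induct)
  case (step N)
  then show ?case using integrate_out_absent[OF assms(1), of "Suc N"] by simp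
qed simp

lemma prod_E_eq:
  assumes "f \<in> cyl d n"
  shows "prod_E f = iterated n f (\<lambda>_ _. 0)"
proof -
  define N where "N = (SOME n. f \<in> cyl d n)"
  have N: "f \<in> cyl d N" unfolding N_def using assms by (rule someI)
  show ?thesis
    using iterated_stable[OF assms, of N] iterated_stable[OF N, of n]
    by (cases "n \<le> N") (auto simp: prod_E_def simp flip: N_def)
qed

lemma iterated_const: "iterated n (\<lambda>_. r) \<xi> = r"
  by (induction n) (simp_all add: integrate_out_def[abs_def] const)

lemma iterated_mono:
  assumes "f \<in> cyl d n" "g \<in> cyl d n" "\<And>\<xi>. f \<xi> \<le> g \<xi>"
  shows "iterated n f \<xi> \<le> iterated n g \<xi>"
  using assms
proof (induction n arbitrary: f g)
  case (Suc n)
  have "integrate_out (Suc n) f \<xi> \<le> integrate_out (Suc n) g \<xi>" for \<xi>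
    unfolding integrate_out_def
    by (rule mono[OF update_mem[OF Suc.prems(2)] update_mem[OF Suc.prems(1)]]) (rule Suc.prems(3))
  then show ?case
    using Suc.IH[OF integrate_out_cyl[OF Suc.prems(1)] integrate_out_cyl[OF Suc.prems(2)]] by simp
qed simp

lemma iterated_subadd:
  assumes "f \<in> cyl d n" "g \<in> cyl d n"
  shows "iterated n (\<lambda>\<xi>. f \<xi> + g \<xi>) \<xi> \<le> iterated n f \<xi> + iterated n g \<xi>"
  using assms
proof (induction n arbitrary: f g)
  case (Suc n)
  let ?f = "integrate_out (Suc n) f" and ?g = "integrate_out (Suc n) g"
  have "iterated n (integrate_out (Suc n) (\<lambda>\<xi>. f \<xi> + g \<xi>)) \<xi>
      \<le> iterated n (\<lambda>\<xi>. ?f \<xi> + ?g \<xi>) \<xi>"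
  proof (rule iterated_mono)
    show "integrate_out (Suc n) (\<lambda>\<xi>. f \<xi> + g \<xi>) \<in> cyl d n"
      "(\<lambda>\<xi>. ?f \<xi> + ?g \<xi>) \<in> cyl d n"
      using Suc.prems integrate_out_cyl[of _ n] by (simp_all add: cyl_def add_poly_lip)
    show "integrate_out (Suc n) (\<lambda>\<xi>. f \<xi> + g \<xi>) \<xi> \<le> ?f \<xi> + ?g \<xi>" for \<xi>
      unfolding integrate_out_def
      by (rule subadd[OF update_mem[OF Suc.prems(1)] update_mem[OF Suc.prems(2)]])
  qed
  also have "\<dots> \<le> iterated n ?f \<xi> + iterated n ?g \<xi>"
    by (rule Suc.IH[OF integrate_out_cyl[OF Suc.prems(1)] integrate_out_cyl[OF Suc.prems(2)]])
  finally show ?case by simp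
qed simp

lemma iterated_pos_homogeneous:
  assumes "f \<in> cyl d n" "0 \<le> r"
  shows "iterated n (\<lambda>\<xi>. r * f \<xi>) \<xi> = r * iterated n f \<xi>"
  using assms(1)
proof (induction n arbitrary: f)
  case (Suc n)
  have "integrate_out (Suc n) (\<lambda>\<xi>. r * f \<xi>) = (\<lambda>\<xi>. r * integrate_out (Suc n) f \<xi>)"
    unfolding integrate_out_def[abs_def]
    by (rule ext, rule pos_homogeneous[OF update_mem[OF Suc.prems] assms(2)])
  then show ?case using Suc.IH[OF integrate_out_cyl[OF Suc.prems]] by simp
qed simp

lemma prod_H_common_cyl:
  fixes k :: nat
  assumes "\<And>j. j < k \<Longrightarrow> Y j \<in> prod_H"
  obtains n where "\<And>j. j < k \<Longrightarrow> Y j \<in> cyl d n"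
proof -
  have "\<forall>j\<in>{..<k}. \<exists>n. Y j \<in> cyl d n" using assms by (auto simp: prod_H_def)
  then obtain N where "\<forall>j\<in>{..<k}. Y j \<in> cyl d (N j)" by (rule bchoice[THEN exE])
  then have N: "Y j \<in> cyl d (N j)" if "j < k" for j using that by simp
  have "Y j \<in> cyl d (Max (N ` {..<k}))" if "j < k" for j
    using cyl_mono[OF N[OF that]] that by simp
  then show thesis using that by blast
qed

lemma prod_H_pair_cyl:
  assumes "f \<in> prod_H" "g \<in> prod_H"
  obtains n where "f \<in> cyl d n" "g \<in> cyl d n"
proof -
  obtain k l where "f \<in> cyl d k" "g \<in> cyl d l" using assms by (auto simp: prod_H_def)
  then show thesis using that[of "max k l"] cyl_mono by simp
qed

lemma sublinear_prod: "sublinear_expectation_space prod_H prod_E"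
proof
  fix k :: nat and Y \<phi>
  assume "1 \<le> k" and Y: "\<And>j. j < k \<Longrightarrow> Y j \<in> prod_H" and \<phi>: "\<phi> \<in> C_l_Lip k"
  obtain n where "Y j \<in> cyl d n" if "j < k" for j
    using prod_H_common_cyl[where k = k and Y = Y] Y by blast
  then have "(\<lambda>\<xi>. \<phi> (\<lambda>j. Y j \<xi>)) \<in> cyl d n"
    by (rule cyl_compose_vector[OF \<phi>])
  then show "(\<lambda>\<xi>. \<phi> (\<lambda>j. Y j \<xi>)) \<in> prod_H" unfolding prod_H_def by (rule UN_I[OF UNIV_I])
next
  fix f g
  assume fg: "f \<in> prod_H" "g \<in> prod_H" and le: "\<And>\<xi>. g \<xi> \<le> f \<xi>"
  from fg obtain n where n: "f \<in> cyl d n" "g \<in> cyl d n" by (rule prod_H_pair_cyl)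
  show "prod_E g \<le> prod_E f"
    unfolding n[THEN prod_E_eq] by (rule iterated_mono[OF n(2,1) le])
next
  fix c :: real
  show "(\<lambda>_. c) \<in> prod_H" by (simp add: prod_H_def const_cyl)
  show "prod_E (\<lambda>_. c) = c" using prod_E_eq[OF const_cyl, of c 0] by simp
next
  fix f g
  assume "f \<in> prod_H" "g \<in> prod_H"
  then obtain n where n: "f \<in> cyl d n" "g \<in> cyl d n" by (rule prod_H_pair_cyl)
  then have sum: "(\<lambda>\<xi>. f \<xi> + g \<xi>) \<in> cyl d n" by (simp add: cyl_def add_poly_lip)
  show "prod_E (\<lambda>\<xi>. f \<xi> + g \<xi>) \<le> prod_E f + prod_E g"
    unfolding n[THEN prod_E_eq] prod_E_eq[OF sum] by (rule iterated_subadd[OF n])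
next
  fix r :: real and f
  assume "f \<in> prod_H" "0 \<le> r"
  then obtain n where n: "f \<in> cyl d n" by (auto simp: prod_H_def)
  then have scaled: "(\<lambda>\<xi>. r * f \<xi>) \<in> cyl d n" by (simp add: cyl_def scale_poly_lip)
  show "prod_E (\<lambda>\<xi>. r * f \<xi>) = r * prod_E f"
    unfolding n[THEN prod_E_eq] prod_E_eq[OF scaled]
    by (rule iterated_pos_homogeneous[OF n \<open>0 \<le> r\<close>])
qed

lemma prod_E_integrate_last:
  assumes "f \<in> cyl d (Suc n)"
  shows "prod_E f = prod_E (integrate_out (Suc n) f)"
  using prod_E_eq[OF assms] prod_E_eq[OF integrate_out_cyl[OF assms]] by simp

text \<open>
  After block \<open>k\<close> has been integrated out a constant is left, which all further integrations preserve.
\<close>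

lemma prod_E_coordinate:
  assumes "1 \<le> k" "\<phi> \<in> C_l_Lip d"
  shows "prod_E (\<lambda>\<xi>. \<phi> (\<xi> k)) = E (\<lambda>w. \<phi> (X k w))"
proof -
  obtain n where k: "k = Suc n" using assms(1) by (cases k) auto
  have "(\<lambda>\<xi>. \<phi> (\<xi> k)) \<in> cyl d (Suc n)"
    by (rule cyl_compose_vector[OF assms(2)]) (simp add: k coord_cyl)
  from prod_E_eq[OF this] show ?thesis
    by (simp add: k integrate_out_def[abs_def] iterated_const)
qed

text \<open>
  The inner expectation in the definition of independence freezes the first \<open>i\<close> blocks and
  integrates the next one, which has the law of \<open>X (Suc i)\<close>. This is exactly the first step of the
  recursion that computes the outer expectation.
\<close>

lemma independent_prod: "independent_sequence prod_E d (\<lambda>i \<xi>. \<xi> i)"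
  unfolding independent_sequence_def independent_from_def
proof (intro allI impI ballI)
  fix i :: nat and \<phi>
  assume "1 \<le> i" and \<phi>: "\<phi> \<in> C_l_Lip (i * d + d)"
  let ?J = "\<lambda>\<xi> y. join (i * d) (blocks d (\<lambda>i \<xi>. \<xi> i) \<xi>) y"
  \<comment> \<open>The first \<open>i * d\<close> coordinates are those of blocks \<open>1, \<dots>, i\<close>.\<close>
  have J_coord: "?J \<xi> (\<xi>' (Suc i)) k = (if k div d < i then \<xi> (Suc (k div d)) (k mod d)
      else \<xi>' (Suc i) (k - i * d))" for \<xi> \<xi>' k
    using dim by (simp add: join_def blocks_def div_less_iff_less_mult)
  have cyl: "(\<lambda>\<xi>. \<phi> (?J \<xi> (\<xi> (Suc i)))) \<in> cyl d (Suc i)"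
    using \<phi>
  proof (rule cyl_compose_vector)
    fix k assume "k < i * d + d"
    then show "(\<lambda>\<xi>. ?J \<xi> (\<xi> (Suc i)) k) \<in> cyl d (Suc i)"
      unfolding J_coord using dim by (cases "k div d < i") (auto intro!: coord_cyl)
  qed
  have inner: "prod_E (\<lambda>\<xi>'. \<phi> (?J \<xi> (\<xi>' (Suc i))))
      = integrate_out (Suc i) (\<lambda>\<xi>. \<phi> (?J \<xi> (\<xi> (Suc i)))) \<xi>" for \<xi>
  proof -
    have "(\<lambda>y. \<phi> (?J \<xi> y)) \<in> C_l_Lip d"
      unfolding C_l_Lip_eq_poly_lip using \<phi>[unfolded C_l_Lip_eq_poly_lip]
    proof (rule poly_lip_compose)
      fix k assume "k \<in> {..<i * d + d}"
      then show "(\<lambda>y. ?J \<xi> y k) \<in> poly_lip {..<d} (\<lambda>j x. x j)"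
        by (cases "k < i * d") (auto simp: join_def const_poly_lip vector_coord_poly_lip)
    qed
    then have "prod_E (\<lambda>\<xi>'. \<phi> (?J \<xi> (\<xi>' (Suc i)))) = E (\<lambda>w. \<phi> (?J \<xi> (X (Suc i) w)))"
      using prod_E_coordinate[of "Suc i" "\<lambda>y. \<phi> (?J \<xi> y)"] by simp
    moreover have "?J (\<xi>(Suc i := y)) y = ?J \<xi> y" for y
      using dim by (auto simp: join_def blocks_def fun_eq_iff div_less_iff_less_mult
          dest!: less_mult_imp_div_less)
    ultimately show ?thesis by (simp add: integrate_out_def)
  qed
  show "prod_E (\<lambda>\<xi>. \<phi> (?J \<xi> (\<xi> (Suc i))))
      = prod_E (\<lambda>\<xi>. prod_E (\<lambda>\<xi>'. \<phi> (?J \<xi> (\<xi>' (Suc i)))))"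
    unfolding inner by (rule prod_E_integrate_last[OF cyl])
qed

text \<open>
  The test function has to be general in the induction, since the step passes from \<open>\<phi>\<close> to its
  average \<open>\<psi>\<close> over the last summand. A bounded Lipschitz \<open>\<phi>\<close> is covered as a special case.
\<close>

lemma expectation_sum_eq:
  assumes conv: "convolutionary_sequence E d X" and n: "1 \<le> n" and \<phi>: "\<phi> \<in> C_l_Lip d"
  shows "E (\<lambda>w. \<phi> (\<lambda>j. \<Sum>i=m+1..m+n. X i w j)) = prod_E (\<lambda>\<xi>. \<phi> (\<lambda>j. \<Sum>i=m+1..m+n. \<xi> i j))"
  using n \<phi>
proof (induction n arbitrary: \<phi> rule: dec_induct)
  case base
  then show ?case using prod_E_coordinate[of "m + 1" \<phi>] by simp
next
  case (step n)
  let ?k = "Suc (m + n)"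
  define \<psi> where "\<psi> x = E (\<lambda>w. \<phi> (\<lambda>j. x j + X ?k w j))" for x
  have "\<psi> \<in> C_l_Lip d"
  proof -
    let ?B = "{..<d} <+> {..<d}" and ?b = "pair_coord (\<lambda>j x. x j) :: nat + nat \<Rightarrow> _"
    have "(\<lambda>p. \<phi> (\<lambda>j. fst p j + snd p j)) \<in> poly_lip ?B ?b"
      using step.prems unfolding C_l_Lip_eq_poly_lip
    proof (rule poly_lip_compose)
      fix j assume "j \<in> {..<d}"
      then show "(\<lambda>p. fst p j + snd p j) \<in> poly_lip ?B ?b"
        using coord_poly_lip[of ?B "Inl j" ?b] coord_poly_lip[of ?B "Inr j" ?b]
        by (intro add_poly_lip) (simp_all add: pair_coord_def[abs_def] InlI InrI)
    qed
    from partial_expectation_poly_lip[OF dim random _ this, of ?k]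
    show ?thesis by (simp add: C_l_Lip_eq_poly_lip \<psi>_def[abs_def])
  qed
  have split: "(\<Sum>i=m+1..m+Suc n. f i) = (\<Sum>i=m+1..m+n. f i) + f ?k" for f :: "nat \<Rightarrow> real"
    by simp
  have cyl: "(\<lambda>\<xi>. \<phi> (\<lambda>j. \<Sum>i=m+1..m+Suc n. \<xi> i j)) \<in> cyl d ?k"
  proof (rule cyl_compose_vector[OF step.prems])
    fix j assume "j < d"
    then show "(\<lambda>\<xi>. \<Sum>i=m+1..m+Suc n. \<xi> i j) \<in> cyl d ?k"
      using coord_cyl[of _ ?k j d] unfolding cyl_def by (intro sum_poly_lip) auto
  qed
  have "of_convolution E d (X (Suc (m + n))) (\<lambda>w j. \<Sum>i=m+1..m+n. X i w j)"
    using conv step.hyps unfolding convolutionary_sequence_def by simp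
  then have "E (\<lambda>w. \<phi> (\<lambda>j. \<Sum>i=m+1..m+Suc n. X i w j)) = E (\<lambda>w. \<psi> (\<lambda>j. \<Sum>i=m+1..m+n. X i w j))"
    unfolding split \<psi>_def of_convolution_def using step.prems by blast
  also have "\<dots> = prod_E (\<lambda>\<xi>. \<psi> (\<lambda>j. \<Sum>i=m+1..m+n. \<xi> i j))"
    by (rule step.IH) fact
  also have "(\<lambda>\<xi>. \<psi> (\<lambda>j. \<Sum>i=m+1..m+n. \<xi> i j))
      = integrate_out ?k (\<lambda>\<xi>. \<phi> (\<lambda>j. \<Sum>i=m+1..m+Suc n. \<xi> i j))"
    unfolding split integrate_out_def[abs_def] \<psi>_def by (auto simp: fun_eq_iff)
  also have "prod_E \<dots> = prod_E (\<lambda>\<xi>. \<phi> (\<lambda>j. \<Sum>i=m+1..m+Suc n. \<xi> i j))"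
    by (rule prod_E_integrate_last[OF cyl, symmetric])
  finally show ?case .
qed

end

section \<open>The independent copy of a convolutionary sequence\<close>

theorem theorem6:
  fixes H :: "('w \<Rightarrow> real) set" and E :: "('w \<Rightarrow> real) \<Rightarrow> real"
    and d :: nat and X :: "nat \<Rightarrow> 'w \<Rightarrow> nat \<Rightarrow> real"
  assumes "sublinear_expectation_space H E"
    and "d \<ge> 1"
    and "\<And>i. i \<ge> 1 \<Longrightarrow> random_vector H d (X i)"
    and "convolutionary_sequence E d X"
  shows "\<exists>(H' :: ((nat \<Rightarrow> nat \<Rightarrow> real) \<Rightarrow> real) set) E' X'.
    sublinear_expectation_space H' E' \<and>
    (\<forall>i\<ge>1. random_vector H' d (X' i)) \<and>
    independent_sequence E' d X' \<and>
    (\<forall>i\<ge>1. identically_distributed d E' (X' i) E (X i)) \<and>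
    (\<forall>m. \<forall>n\<ge>1. \<forall>\<phi>\<in>C_b_Lip d.
       E (\<lambda>\<omega>. \<phi> (\<lambda>j. \<Sum>i=m+1..m+n. X i \<omega> j)) =
       E' (\<lambda>\<omega>. \<phi> (\<lambda>j. \<Sum>i=m+1..m+n. X' i \<omega> j)))"
proof -
  interpret sublinear_expectation_space H E by (rule assms(1))
  interpret random_sequence H E d X
    by unfold_locales (use assms in auto)
  show ?thesis
  proof (intro exI[of _ prod_H] exI[of _ prod_E] exI[of _ "\<lambda>i \<omega>. \<omega> i"] conjI allI impI ballI)
    show "random_vector prod_H d (\<lambda>\<omega>. \<omega> i)" if "1 \<le> i" for i
      unfolding random_vector_def prod_H_def using coord_cyl[of i i] that by auto
    show "identically_distributed d prod_E (\<lambda>\<omega>. \<omega> i) E (X i)" if "1 \<le> i" for i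
      using prod_E_coordinate[OF that] by (simp add: identically_distributed_def)
    show "E (\<lambda>\<omega>. \<phi> (\<lambda>j. \<Sum>i=m+1..m+n. X i \<omega> j))
        = prod_E (\<lambda>\<omega>. \<phi> (\<lambda>j. \<Sum>i=m+1..m+n. \<omega> i j))" if "1 \<le> n" "\<phi> \<in> C_b_Lip d" for m n \<phi>
      by (rule expectation_sum_eq[OF assms(4) that(1) subsetD[OF C_b_Lip_subset_C_l_Lip that(2)]])
  qed (fact sublinear_prod independent_prod)+
qed

end
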